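(* In the Second Fraenkel Model $\mathcal N_2$, $\mathsf{HT}$ holds.
   Context: The Second Fraenkel Model $\mathcal N_2$ is the Fraenkel–Mostowski permutation model of $\mathsf{ZFA}$ whose set of atoms is $A=\bigcup_{n<\omega}P_n$ with the $P_n$ pairwise disjoint two-element sets, the group consists of all permutations $\pi$ of $A$ with $\pi[P_n]=P_n$ for all $n$, and the normal filter is generated by pointwise stabilizers of finite subsets of $A$ (finite supports); it consists of the hereditarily symmetric sets. $[X]^{<\omega}$ is the set of finite subsets of $X$; for $Y\subseteq[X]^{<\omega}$, $\mathrm{FU}(Y)=\{\bigcup_{y\in F}y : F\subseteq Y\text{ finite nonempty}\}$. $\mathsf{HT}$: for every infinite set $X$ and every $c:[X]^{<\omega}\to 2$ there is an infinite pairwise disjoint $Y\subseteq[X]^{<\omega}$ with $\mathrm{FU}(Y)$ $c$-monochromatic. *)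

theory Defs
  imports Main "HOL-Combinatorics.Permutations" "HOL-Library.Disjoint_Sets"
begin

section \<open>The sentence HT in a structure for the language of set theory with atoms\<close>

text \<open>
  A structure consists of a domain \<open>D\<close>, a membership relation and a predicate singling out
  the atoms.  Below, every quantifier is bounded by \<open>D\<close>, so that \<open>HT\<close> is the relativisation
  to \<open>D\<close> of the usual set-theoretic sentence.
\<close>

locale set_structure =
  fixes D :: "'v set"
    and mem :: "'v \<Rightarrow> 'v \<Rightarrow> bool"  (infix "\<^bold>\<in>" 50)
    and atom :: "'v \<Rightarrow> bool"
begin

definition is_set :: "'v \<Rightarrow> bool" where
  "is_set x \<longleftrightarrow> x \<in> D \<and> \<not> atom x"

definition is_empty :: "'v \<Rightarrow> bool" where
  "is_empty x \<longleftrightarrow> is_set x \<and> (\<forall>z\<in>D. \<not> z \<^bold>\<in> x)"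

definition is_subset :: "'v \<Rightarrow> 'v \<Rightarrow> bool" where
  "is_subset x y \<longleftrightarrow> is_set x \<and> is_set y \<and> (\<forall>z\<in>D. z \<^bold>\<in> x \<longrightarrow> z \<^bold>\<in> y)"

definition is_upair :: "'v \<Rightarrow> 'v \<Rightarrow> 'v \<Rightarrow> bool" where
  "is_upair u x y \<longleftrightarrow> is_set u \<and> (\<forall>z\<in>D. z \<^bold>\<in> u \<longleftrightarrow> z = x \<or> z = y)"

text \<open>\<open>p\<close> is the Kuratowski pair \<open>{{x}, {x, y}}\<close>.\<close>

definition is_opair :: "'v \<Rightarrow> 'v \<Rightarrow> 'v \<Rightarrow> bool" where
  "is_opair p x y \<longleftrightarrow> (\<exists>u\<in>D. \<exists>v\<in>D. is_upair u x x \<and> is_upair v x y \<and> is_upair p u v)"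

definition is_succ :: "'v \<Rightarrow> 'v \<Rightarrow> bool" where
  "is_succ y x \<longleftrightarrow> is_set y \<and> (\<forall>z\<in>D. z \<^bold>\<in> y \<longleftrightarrow> z \<^bold>\<in> x \<or> z = x)"

definition is_Union :: "'v \<Rightarrow> 'v \<Rightarrow> bool" where
  "is_Union u F \<longleftrightarrow> is_set u \<and> (\<forall>z\<in>D. z \<^bold>\<in> u \<longleftrightarrow> (\<exists>y\<in>D. y \<^bold>\<in> F \<and> z \<^bold>\<in> y))"

definition is_inductive :: "'v \<Rightarrow> bool" where
  "is_inductive I \<longleftrightarrow> is_set I \<and> (\<exists>z\<in>D. is_empty z \<and> z \<^bold>\<in> I) \<and>
     (\<forall>x\<in>D. x \<^bold>\<in> I \<longrightarrow> (\<exists>y\<in>D. is_succ y x \<and> y \<^bold>\<in> I))"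

text \<open>\<open>n\<close> is an element of \<open>\<omega>\<close>, the least inductive set.\<close>

definition is_nat :: "'v \<Rightarrow> bool" where
  "is_nat n \<longleftrightarrow> n \<in> D \<and> (\<forall>I\<in>D. is_inductive I \<longrightarrow> n \<^bold>\<in> I)"

definition maps_to :: "'v \<Rightarrow> 'v \<Rightarrow> 'v \<Rightarrow> bool" where
  "maps_to f x y \<longleftrightarrow> (\<exists>p\<in>D. p \<^bold>\<in> f \<and> is_opair p x y)"

text \<open>
  \<open>f\<close> is a set of ordered pairs that is a function from \<open>S\<close> to \<open>T\<close>.  Domain and codomain are
  given by the properties defining their elements; this allows to speak of a function on
  the finite subsets of \<open>X\<close> without a separate quantifier for the set of these.
\<close>

definition is_function :: "'v \<Rightarrow> ('v \<Rightarrow> bool) \<Rightarrow> ('v \<Rightarrow> bool) \<Rightarrow> bool" where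
  "is_function f S T \<longleftrightarrow> is_set f \<and>
     (\<forall>p\<in>D. p \<^bold>\<in> f \<longrightarrow> (\<exists>x\<in>D. \<exists>y\<in>D. S x \<and> T y \<and> is_opair p x y)) \<and>
     (\<forall>x\<in>D. S x \<longrightarrow> (\<exists>!y. y \<in> D \<and> maps_to f x y))"

definition is_bijection :: "'v \<Rightarrow> 'v \<Rightarrow> 'v \<Rightarrow> bool" where
  "is_bijection f x y \<longleftrightarrow> is_function f (\<lambda>z. z \<^bold>\<in> x) (\<lambda>w. w \<^bold>\<in> y) \<and>
     (\<forall>w\<in>D. w \<^bold>\<in> y \<longrightarrow> (\<exists>!z. z \<in> D \<and> maps_to f z w))"

definition is_finite :: "'v \<Rightarrow> bool" where
  "is_finite x \<longleftrightarrow> is_set x \<and> (\<exists>n\<in>D. \<exists>f\<in>D. is_nat n \<and> is_bijection f n x)"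

definition is_infinite :: "'v \<Rightarrow> bool" where
  "is_infinite x \<longleftrightarrow> is_set x \<and> \<not> is_finite x"

text \<open>\<open>y\<close> is a finite subset of \<open>X\<close>.\<close>

definition in_Fin :: "'v \<Rightarrow> 'v \<Rightarrow> bool" where
  "in_Fin X y \<longleftrightarrow> is_subset y X \<and> is_finite y"

text \<open>\<open>i \<in> 2 = {\<emptyset>, {\<emptyset>}}\<close>\<close>

definition in_two :: "'v \<Rightarrow> bool" where
  "in_two i \<longleftrightarrow> is_empty i \<or> (\<exists>z\<in>D. is_empty z \<and> is_succ i z)"

text \<open>\<open>u \<in> FU(Y)\<close>\<close>

definition in_FU :: "'v \<Rightarrow> 'v \<Rightarrow> bool" where
  "in_FU Y u \<longleftrightarrow>
     (\<exists>F\<in>D. is_subset F Y \<and> is_finite F \<and> \<not> is_empty F \<and> is_Union u F)"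

definition pairwise_disjoint :: "'v \<Rightarrow> bool" where
  "pairwise_disjoint Y \<longleftrightarrow>
     (\<forall>x\<in>D. \<forall>y\<in>D. x \<^bold>\<in> Y \<and> y \<^bold>\<in> Y \<and> x \<noteq> y \<longrightarrow> \<not> (\<exists>z\<in>D. z \<^bold>\<in> x \<and> z \<^bold>\<in> y))"

definition FU_monochromatic :: "'v \<Rightarrow> 'v \<Rightarrow> bool" where
  "FU_monochromatic c Y \<longleftrightarrow> (\<exists>i\<in>D. in_two i \<and> (\<forall>u\<in>D. in_FU Y u \<longrightarrow> maps_to c u i))"

definition HT :: bool where
  "HT \<longleftrightarrow>
     (\<forall>X\<in>D. \<forall>c\<in>D. is_infinite X \<and> is_function c (in_Fin X) in_two \<longrightarrow>
        (\<exists>Y\<in>D. is_infinite Y \<and> (\<forall>y\<in>D. y \<^bold>\<in> Y \<longrightarrow> in_Fin X y) \<and>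
           pairwise_disjoint Y \<and> FU_monochromatic c Y))"

end


section \<open>Universes of set theory with atoms\<close>

text \<open>
  The type \<open>'v\<close> is the universe of all sets and atoms.  Separation and Replacement are stated
  for arbitrary HOL predicates and functions.  The axiom of choice in the universe
  then follows from Hilbert choice and Separation.
\<close>

locale zfa =
  fixes mem :: "'v \<Rightarrow> 'v \<Rightarrow> bool"  (infix "\<^bold>\<in>" 50)
    and atom :: "'v \<Rightarrow> bool"
  assumes atom_no_elements: "atom a \<Longrightarrow> \<not> x \<^bold>\<in> a"
    and atoms_set: "\<exists>A. \<not> atom A \<and> (\<forall>a. a \<^bold>\<in> A \<longleftrightarrow> atom a)"
    and extensionality:
      "\<not> atom x \<Longrightarrow> \<not> atom y \<Longrightarrow> (\<And>z. z \<^bold>\<in> x \<longleftrightarrow> z \<^bold>\<in> y) \<Longrightarrow> x = y"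
    and foundation: "z \<^bold>\<in> x \<Longrightarrow> \<exists>y. y \<^bold>\<in> x \<and> (\<forall>w. w \<^bold>\<in> x \<longrightarrow> \<not> w \<^bold>\<in> y)"
    and pairing: "\<exists>u. \<not> atom u \<and> (\<forall>z. z \<^bold>\<in> u \<longleftrightarrow> z = x \<or> z = y)"
    and union: "\<exists>u. \<not> atom u \<and> (\<forall>z. z \<^bold>\<in> u \<longleftrightarrow> (\<exists>y. y \<^bold>\<in> x \<and> z \<^bold>\<in> y))"
    and powerset:
      "\<exists>p. \<not> atom p \<and> (\<forall>y. y \<^bold>\<in> p \<longleftrightarrow> \<not> atom y \<and> (\<forall>z. z \<^bold>\<in> y \<longrightarrow> z \<^bold>\<in> x))"
    and infinity:
      "\<exists>I. (\<exists>e. e \<^bold>\<in> I \<and> \<not> atom e \<and> (\<forall>z. \<not> z \<^bold>\<in> e)) \<and>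
           (\<forall>x. x \<^bold>\<in> I \<longrightarrow> (\<exists>y. y \<^bold>\<in> I \<and> (\<forall>z. z \<^bold>\<in> y \<longleftrightarrow> z \<^bold>\<in> x \<or> z = x)))"
    and separation: "\<exists>y. \<not> atom y \<and> (\<forall>z. z \<^bold>\<in> y \<longleftrightarrow> z \<^bold>\<in> x \<and> Q z)"
    and replacement: "\<exists>y. \<not> atom y \<and> (\<forall>w. w \<^bold>\<in> y \<longleftrightarrow> (\<exists>z. z \<^bold>\<in> x \<and> w = F z))"
begin

text \<open>The set of the universe whose elements are the members of \<open>S\<close>, if there is one.\<close>

definition set_of :: "'v set \<Rightarrow> 'v" where
  "set_of S = (THE x. \<not> atom x \<and> (\<forall>z. z \<^bold>\<in> x \<longleftrightarrow> z \<in> S))"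

text \<open>
  The extension of a permutation \<open>\<pi>\<close> of the atoms to the universe, by recursion on membership;
  see \<open>act_atom\<close>, \<open>act_not_atom\<close> and \<open>mem_act\<close> below for the defining equations.
\<close>

definition act :: "('v \<Rightarrow> 'v) \<Rightarrow> 'v \<Rightarrow> 'v" where
  "act \<pi> = wfrec {(y, x). y \<^bold>\<in> x}
     (\<lambda>f x. if atom x then \<pi> x else set_of (f ` {y. y \<^bold>\<in> x}))"

lemma mem_asym:
  assumes "x \<^bold>\<in> y" shows "\<not> y \<^bold>\<in> x"
proof -
  obtain u where u: "\<And>z. z \<^bold>\<in> u \<longleftrightarrow> z = x \<or> z = y"
    using pairing by meson
  then have "x \<^bold>\<in> u" by simp
  from foundation[OF this] show ?thesis using u assms by metis
qed

text \<open>Foundation for sets yields well-foundedness, since Replacement makes every sequence a set.\<close>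

lemma wf_mem: "wf {(y, x). y \<^bold>\<in> x}"
proof (rule ccontr)
  assume "\<not> wf {(y, x). y \<^bold>\<in> x}"
  then obtain f :: "nat \<Rightarrow> 'v" where f: "\<And>n. f (Suc n) \<^bold>\<in> f n"
    unfolding wf_iff_no_infinite_down_chain by auto
  obtain I e where e: "e \<^bold>\<in> I" "\<And>z. \<not> z \<^bold>\<in> e"
    and I: "\<And>x. x \<^bold>\<in> I \<Longrightarrow> \<exists>y. y \<^bold>\<in> I \<and> (\<forall>z. z \<^bold>\<in> y \<longleftrightarrow> z \<^bold>\<in> x \<or> z = x)"
    using infinity by blast
  then obtain s where s: "\<And>x. x \<^bold>\<in> I \<Longrightarrow> s x \<^bold>\<in> I"
    and s': "\<And>x z. x \<^bold>\<in> I \<Longrightarrow> z \<^bold>\<in> s x \<longleftrightarrow> z \<^bold>\<in> x \<or> z = x"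
    by metis
  define g where "g n = (s ^^ n) e" for n
  have gI: "g n \<^bold>\<in> I" for n
    by (induction n) (auto simp: g_def e s)
  have g0: "g 0 = e" and gS: "g (Suc n) = s (g n)" for n
    by (auto simp: g_def)
  have "g m = g n \<Longrightarrow> m = n" for m n
  proof (induction m arbitrary: n)
    case 0
    then show ?case using e(2) s'[OF gI] g0 gS by (cases n) metis+
  next
    case (Suc m)
    then obtain k where k: "n = Suc k"
      using e(2) s'[OF gI] g0 gS by (cases n) metis+
    have "s (g m) = s (g k)" using Suc.prems k gS by simp
    then have "g m = g k" using s'[OF gI] mem_asym by metis
    then show ?case using Suc.IH k by simp
  qed
  then have inj: "inj g" by (rule injI)
  obtain y where y: "\<And>w. w \<^bold>\<in> y \<longleftrightarrow> (\<exists>z. z \<^bold>\<in> I \<and> w = f (inv g z))"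
    using replacement[of I "\<lambda>z. f (inv g z)"] by blast
  have fy: "f n \<^bold>\<in> y" for n
    using y gI inv_f_f[OF inj] by metis
  from foundation[OF fy] show False
    using y fy f by metis
qed

lemma set_of_mem:
  assumes "\<not> atom y" "\<And>z. z \<^bold>\<in> y \<longleftrightarrow> z \<in> S"
  shows "set_of S = y"
  unfolding set_of_def using assms extensionality by (intro the_equality) auto

lemma act_unfold:
  "act \<pi> x = (if atom x then \<pi> x else set_of (act \<pi> ` {y. y \<^bold>\<in> x}))"
proof -
  have "cut (act \<pi>) {(y, x). y \<^bold>\<in> x} x ` {y. y \<^bold>\<in> x} = act \<pi> ` {y. y \<^bold>\<in> x}"
    by (intro image_cong) (auto simp: cut_def)
  then show ?thesis
    using wfrec[OF wf_mem, of "\<lambda>f x. if atom x then \<pi> x else set_of (f ` {y. y \<^bold>\<in> x})" x]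
    unfolding act_def by simp
qed

lemma act_atom: "atom a \<Longrightarrow> act \<pi> a = \<pi> a"
  by (subst act_unfold) simp

lemma set_of_act:
  assumes "\<not> atom x"
  shows "\<not> atom (act \<pi> x) \<and> (\<forall>z. z \<^bold>\<in> act \<pi> x \<longleftrightarrow> (\<exists>y. y \<^bold>\<in> x \<and> z = act \<pi> y))"
proof -
  obtain w where w: "\<not> atom w" "\<And>z. z \<^bold>\<in> w \<longleftrightarrow> (\<exists>y. y \<^bold>\<in> x \<and> z = act \<pi> y)"
    using replacement[of x "act \<pi>"] by blast
  then have "set_of (act \<pi> ` {y. y \<^bold>\<in> x}) = w"
    by (intro set_of_mem) auto
  then show ?thesis using w assms by (subst (1 2) act_unfold) auto
qed

lemma act_not_atom: "\<not> atom x \<Longrightarrow> \<not> atom (act \<pi> x)"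
  using set_of_act by blast

lemma mem_act: "\<not> atom x \<Longrightarrow> z \<^bold>\<in> act \<pi> x \<longleftrightarrow> (\<exists>y. y \<^bold>\<in> x \<and> z = act \<pi> y)"
  using set_of_act by blast

end


section \<open>The Second Fraenkel Model\<close>

locale second_fraenkel = zfa mem atom
  for mem :: "'v \<Rightarrow> 'v \<Rightarrow> bool"  (infix "\<^bold>\<in>" 50) and atom :: "'v \<Rightarrow> bool" +
  fixes P :: "nat \<Rightarrow> 'v set"
  assumes card_P: "card (P n) = 2"
    and disjoint_P: "disjoint_family P"
    and atoms_P: "{a. atom a} = (\<Union>n. P n)"
begin

definition G :: "('v \<Rightarrow> 'v) set" where
  "G = {\<pi>. \<pi> permutes {a. atom a} \<and> (\<forall>n. \<pi> ` P n = P n)}"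

definition pointwise_stabilizer :: "'v set \<Rightarrow> ('v \<Rightarrow> 'v) set" where
  "pointwise_stabilizer E = {\<pi> \<in> G. \<forall>a\<in>E. \<pi> a = a}"

definition stabilizer :: "'v \<Rightarrow> ('v \<Rightarrow> 'v) set" where
  "stabilizer x = {\<pi> \<in> G. act \<pi> x = x}"

text \<open>
  The stabilizer of \<open>x\<close> belongs to the filter of subgroups of \<open>G\<close> generated by the pointwise
  stabilizers of finite sets of atoms.  As these are closed under finite intersections, this
  means that it contains one of them.
\<close>

definition symmetric :: "'v \<Rightarrow> bool" where
  "symmetric x \<longleftrightarrow>
     (\<exists>E. finite E \<and> E \<subseteq> {a. atom a} \<and> pointwise_stabilizer E \<subseteq> stabilizer x)"

text \<open>
  The class of hereditarily symmetric objects: \<open>x\<close> and all elements of its transitive closure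
  are symmetric.
\<close>

definition N2 :: "'v set" where
  "N2 = {x. \<forall>y. mem\<^sup>*\<^sup>* y x \<longrightarrow> symmetric y}"

end

end

theory Submission
  imports Defs
begin

text \<open>
  Let \<open>E\<close> be a finite support of \<open>X\<close>.  The pointwise stabilizer of \<open>E\<close> acts on \<open>X\<close> with
  finite orbits, because the image of an element supported by a finite set \<open>E'\<close> depends only on the
  restriction of the permutation to \<open>E'\<close>, and there are only finitely many such restrictions, as
  permutations in the group preserve the finite sets \<open>P n\<close>.  So \<open>X\<close> splits
  into infinitely many finite orbits.  Hindman's finite unions theorem, applied in the universe to
  this disjoint collection of orbits, yields an infinite disjoint collection \<open>Y\<close> of finite unions
  of orbits with \<open>FU(Y)\<close> monochromatic.  Every element of \<open>Y\<close> is fixed by the pointwise stabilizer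
  of \<open>E\<close>, hence \<open>Y\<close> lies in the model.
\<close>

section \<open>Hindman's finite unions theorem\<close>

definition FU :: "'a set set \<Rightarrow> 'a set set" where
  "FU D = {\<Union>F |F. F \<subseteq> D \<and> finite F \<and> F \<noteq> {}}"

definition disjoint_collection :: "'a set set \<Rightarrow> bool" where
  "disjoint_collection D \<longleftrightarrow> infinite D \<and> disjoint D \<and> (\<forall>d\<in>D. finite d \<and> d \<noteq> {})"

text \<open>Baumgartner's notion of largeness, taken relative to \<open>D\<close>. It passes to
  every collection inside \<open>FU D\<close>, and a finite partition keeps it for some piece after
  a refinement of \<open>D\<close>.\<close>

definition large :: "'a set set \<Rightarrow> 'a set set \<Rightarrow> bool" where
  "large X D \<longleftrightarrow> (\<forall>D'. disjoint_collection D' \<longrightarrow> D' \<subseteq> FU D \<longrightarrow> X \<inter> FU D' \<noteq> {})"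

lemma FU_E:
  assumes "x \<in> FU D"
  obtains F where "x = \<Union>F" "F \<subseteq> D" "finite F" "F \<noteq> {}"
  using assms unfolding FU_def by blast

lemma subset_FU: "D \<subseteq> FU D"
proof
  fix d assume "d \<in> D"
  then show "d \<in> FU D" unfolding FU_def by (intro CollectI exI[of _ "{d}"]) auto
qed

lemma Un_in_FU:
  assumes "x \<in> FU D" "y \<in> FU D"
  shows "x \<union> y \<in> FU D"
proof -
  obtain F G where F: "x = \<Union>F" "F \<subseteq> D" "finite F" "F \<noteq> {}"
    and G: "y = \<Union>G" "G \<subseteq> D" "finite G"
    using assms unfolding FU_def by blast
  then have "x \<union> y = \<Union>(F \<union> G)" "F \<union> G \<subseteq> D" "finite (F \<union> G)" "F \<union> G \<noteq> {}" by auto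
  then show ?thesis unfolding FU_def by blast
qed

lemma Union_in_FU:
  assumes "finite F" "F \<noteq> {}" "F \<subseteq> FU D"
  shows "\<Union>F \<in> FU D"
  using assms by (induction F rule: finite_ne_induct) (auto intro: Un_in_FU)

lemma FU_subset_FU:
  assumes "D' \<subseteq> FU D"
  shows "FU D' \<subseteq> FU D"
proof
  fix x assume "x \<in> FU D'"
  then obtain F where "x = \<Union>F" "F \<subseteq> D'" "finite F" "F \<noteq> {}" by (rule FU_E)
  then show "x \<in> FU D" using Union_in_FU[of F D] assms by simp
qed

lemma FU_mono: "D' \<subseteq> D \<Longrightarrow> FU D' \<subseteq> FU D"
  by (rule FU_subset_FU) (rule order_trans[OF _ subset_FU])

lemma finite_nonempty_FU:
  assumes "disjoint_collection D" "x \<in> FU D"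
  shows "finite x \<and> x \<noteq> {}"
proof -
  obtain F where F: "x = \<Union>F" "F \<subseteq> D" "finite F" "F \<noteq> {}" using assms(2) by (rule FU_E)
  then have "\<forall>d\<in>F. finite d \<and> d \<noteq> {}" using assms(1) unfolding disjoint_collection_def by blast
  then show ?thesis using F by auto
qed

lemma FU_disjoint_from:
  assumes "x \<in> FU D" "\<And>d. d \<in> D \<Longrightarrow> d \<inter> S = {}"
  shows "x \<inter> S = {}"
proof -
  obtain F where "x = \<Union>F" "F \<subseteq> D" using assms(1) by (rule FU_E)
  then show ?thesis using assms(2) by blast
qed

text \<open>Two equal blocks with different indices would be disjoint from themselves, hence empty.
  So the enumeration is injective and its range is infinite.\<close>

lemma disjoint_collection_range:
  fixes y :: "nat \<Rightarrow> 'a set"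
  assumes "\<And>n. finite (y n) \<and> y n \<noteq> {}" "\<And>m n. m < n \<Longrightarrow> y m \<inter> y n = {}"
  shows "disjoint_collection (range y)"
proof -
  have dis: "m \<noteq> n \<Longrightarrow> y m \<inter> y n = {}" for m n
    using assms(2)[of m n] assms(2)[of n m] by (cases m n rule: linorder_cases) auto
  then have "inj y"
    using assms(1) by (intro injI) (metis inf.idem)
  then have "infinite (range y)" by (simp add: finite_image_iff)
  moreover have "disjoint (range y)"
  proof (rule disjointI)
    fix a b assume "a \<in> range y" "b \<in> range y" "a \<noteq> b"
    then obtain m n where "a = y m" "b = y n" "m \<noteq> n" by auto
    then show "a \<inter> b = {}" using dis by simp
  qed
  ultimately show ?thesis
    using assms(1) unfolding disjoint_collection_def by blast
qed

text \<open>By disjointness each point of \<open>S\<close> lies in at most one member of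
  \<open>D\<close>, so only finitely many members are discarded.\<close>

lemma disjoint_collection_away:
  assumes D: "disjoint_collection D" and "finite S"
  shows "disjoint_collection {d\<in>D. d \<inter> S = {}}"
proof -
  have "{d\<in>D. d \<inter> S \<noteq> {}} \<subseteq> (\<Union>s\<in>S. {d\<in>D. s \<in> d})"
    by blast
  moreover have "finite {d\<in>D. s \<in> d}" for s
  proof (cases "\<exists>d\<in>D. s \<in> d")
    case True
    then obtain d where "d \<in> D" "s \<in> d" by blast
    then have "{d\<in>D. s \<in> d} \<subseteq> {d}"
      using D unfolding disjoint_collection_def disjoint_def by blast
    then show ?thesis using finite_subset by blast
  next
    case False
    then have "{d\<in>D. s \<in> d} = {}" by blast
    then show ?thesis by (metis finite.emptyI)
  qed
  ultimately have "finite {d\<in>D. d \<inter> S \<noteq> {}}"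
    using \<open>finite S\<close> by (meson finite_UN_I finite_subset)
  moreover have "infinite D" using D unfolding disjoint_collection_def by blast
  ultimately have "infinite (D - {d\<in>D. d \<inter> S \<noteq> {}})" by (rule Diff_infinite_finite)
  moreover have "D - {d\<in>D. d \<inter> S \<noteq> {}} = {d\<in>D. d \<inter> S = {}}" by auto
  ultimately have "infinite {d\<in>D. d \<inter> S = {}}" by simp
  moreover have "disjoint {d\<in>D. d \<inter> S = {}}"
    using D unfolding disjoint_collection_def disjoint_def by simp
  ultimately show ?thesis
    using D unfolding disjoint_collection_def by blast
qed

section \<open>Large families and Baumgartner's construction\<close>

lemma large_mono:
  "large X D \<Longrightarrow> D' \<subseteq> FU D \<Longrightarrow> large X D'"
  unfolding large_def using FU_subset_FU by blast

text \<open>If \<open>Z j\<close> is not large for \<open>D\<close>, some refinement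
  \<open>D'\<close> has no finite union in \<open>Z j\<close>. There the remaining pieces cover
  \<open>X\<close>, and the induction hypothesis applies. With no pieces left, largeness tested on
  \<open>D\<close> itself is contradictory.\<close>

lemma large_partition:
  assumes "finite I"
  shows "disjoint_collection D \<Longrightarrow> large X D \<Longrightarrow> X \<inter> FU D \<subseteq> (\<Union>i\<in>I. Z i) \<Longrightarrow>
    \<exists>i\<in>I. \<exists>D'. disjoint_collection D' \<and> D' \<subseteq> FU D \<and> large (Z i) D'"
  using assms
proof (induction I arbitrary: D rule: finite_induct)
  case empty
  then show ?case unfolding large_def using subset_FU by fastforce
next
  case (insert j I)
  show ?case
  proof (cases "large (Z j) D")
    case True
    then show ?thesis using insert.prems(1) subset_FU by blast
  next
    case False
    then obtain D' where D': "disjoint_collection D'" "D' \<subseteq> FU D" "Z j \<inter> FU D' = {}"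
      unfolding large_def by blast
    have "X \<inter> FU D' \<subseteq> (\<Union>i\<in>I. Z i)"
      using insert.prems(3) D'(3) FU_subset_FU[OF D'(2)] by blast
    then obtain i D'' where "i \<in> I" "disjoint_collection D''" "D'' \<subseteq> FU D'" "large (Z i) D''"
      using insert.IH[OF D'(1) large_mono[OF insert.prems(2) D'(2)]] by blast
    then show ?thesis using FU_subset_FU[OF D'(2)] by blast
  qed
qed

text \<open>Blocks are chosen one after another, each off the points used before. A finite union of
  blocks is its last block together with a union \<open>d\<close> of earlier ones, so
  \<open>ext\<close> puts it into \<open>Z\<close>; the case \<open>d = {}\<close> covers a single
  block.\<close>

lemma greedy_disjoint_collection:
  fixes D :: "'a set set"
  assumes D: "disjoint_collection D"
    and ext: "\<And>S. finite S \<Longrightarrow> \<exists>y\<in>FU D. y \<inter> S = {} \<and>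
      (\<forall>d. d \<subseteq> S \<longrightarrow> d \<in> insert {} (FU D) \<longrightarrow> d \<union> y \<in> Z)"
  shows "\<exists>D'. disjoint_collection D' \<and> D' \<subseteq> FU D \<and> FU D' \<subseteq> Z"
proof -
  obtain next_block where nb: "\<And>S. finite S \<Longrightarrow> next_block S \<in> FU D \<and> next_block S \<inter> S = {} \<and>
      (\<forall>d. d \<subseteq> S \<longrightarrow> d \<in> insert {} (FU D) \<longrightarrow> d \<union> next_block S \<in> Z)"
    using ext by metis
  \<comment> \<open>\<open>S n\<close> collects the points of the blocks with index below
    \<open>n\<close>, and block \<open>n\<close> is chosen to avoid them.\<close>
  define S where "S = rec_nat {} (\<lambda>_ s. s \<union> next_block s)"
  define y where "y n = next_block (S n)" for n
  have SS: "S (Suc n) = S n \<union> y n" for n by (simp add: S_def y_def)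
  have fin: "finite (S n)" for n
  proof (induction n)
    case (Suc n)
    then show ?case using nb[OF Suc] finite_nonempty_FU[OF D] by (simp add: SS y_def)
  qed (simp add: S_def)
  note y = nb[OF fin, folded y_def]
  have sub: "m < n \<Longrightarrow> y m \<subseteq> S n" for m n
    by (induction n) (auto simp: SS less_Suc_eq)
  have dc: "disjoint_collection (range y)"
    using y sub finite_nonempty_FU[OF D] by (intro disjoint_collection_range) blast+
  have "\<Union>(y ` I) \<in> Z" if "finite I" "I \<noteq> {}" for I
  proof -
    define n where "n = Max I"
    have n: "n \<in> I" "\<And>i. i \<in> I \<Longrightarrow> i \<le> n" using that by (auto simp: n_def)
    define d where "d = \<Union>(y ` (I - {n}))"
    have "y i \<subseteq> S n" if "i \<in> I - {n}" for i
      using sub[of i n] n(2)[of i] that by simp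
    then have "d \<subseteq> S n" unfolding d_def by blast
    moreover have "d \<in> insert {} (FU D)"
    proof (cases "I - {n} = {}")
      case False
      then have "d \<in> FU D" unfolding d_def using that(1) y by (intro Union_in_FU) blast+
      then show ?thesis by simp
    next
      case True
      then have "d = {}" unfolding d_def by (simp only: image_empty Union_empty)
      then show ?thesis by simp
    qed
    ultimately have "d \<union> y n \<in> Z" using y by blast
    also have "d \<union> y n = \<Union>(y ` I)" using n(1) by (auto simp: d_def)
    finally show ?thesis .
  qed
  have "FU (range y) \<subseteq> Z"
  proof
    fix u assume "u \<in> FU (range y)"
    then obtain F where F: "u = \<Union>F" "F \<subseteq> range y" "finite F" "F \<noteq> {}"
      by (rule FU_E)
    then obtain I where "finite I" "F = y ` I" using finite_subset_image[of F y UNIV] by blast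
    then show "u \<in> Z" using F \<open>\<And>I. finite I \<Longrightarrow> I \<noteq> {} \<Longrightarrow> \<Union>(y ` I) \<in> Z\<close> by simp
  qed
  then show ?thesis using dc y by blast
qed

text \<open>
  Otherwise a disjoint collection avoiding \<open>X\<close> could be built greedily.  Each of its blocks is a
  union of two sets, as the failure of the claim keeps only unions with earlier sets out of \<open>X\<close>,
  not the new set alone.
\<close>

lemma large_absorbing:
  assumes D: "disjoint_collection D" and X: "large X D"
  shows "\<exists>S. finite S \<and> (\<forall>z\<in>FU D. z \<inter> S = {} \<longrightarrow> (\<exists>d\<in>FU D. d \<subseteq> S \<and> d \<union> z \<in> X))"
proof (rule ccontr)
  assume "\<not> ?thesis"
  then have *: "\<And>S. finite S \<Longrightarrow>
      \<exists>z\<in>FU D. z \<inter> S = {} \<and> (\<forall>d\<in>FU D. d \<subseteq> S \<longrightarrow> d \<union> z \<notin> X)"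
    by meson
  have "\<exists>y\<in>FU D. y \<inter> S = {} \<and>
      (\<forall>d. d \<subseteq> S \<longrightarrow> d \<in> insert {} (FU D) \<longrightarrow> d \<union> y \<in> - X)" if S: "finite S" for S
  proof -
    obtain z where z: "z \<in> FU D" "z \<inter> S = {}" using *[OF S] by blast
    then have "finite (S \<union> z)" using S finite_nonempty_FU[OF D] by blast
    from *[OF this] obtain w where w: "w \<in> FU D" "w \<inter> (S \<union> z) = {}"
      and wX: "\<And>d. d \<in> FU D \<Longrightarrow> d \<subseteq> S \<union> z \<Longrightarrow> d \<union> w \<notin> X" by blast
    have "d \<union> (z \<union> w) \<notin> X" if "d \<subseteq> S" "d \<in> insert {} (FU D)" for d
    proof -
      have "d \<union> z \<in> FU D" using that z(1) Un_in_FU by auto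
      then have "(d \<union> z) \<union> w \<notin> X" using that(1) by (intro wX) auto
      then show ?thesis by (simp add: Un_assoc)
    qed
    moreover have "z \<union> w \<in> FU D" using z(1) w(1) by (rule Un_in_FU)
    moreover have "(z \<union> w) \<inter> S = {}" using z(2) w(2) by blast
    ultimately show ?thesis by blast
  qed
  from greedy_disjoint_collection[OF D this] show False
    using X unfolding large_def by blast
qed

text \<open>A finite \<open>S\<close> from \<open>large_absorbing\<close> has only finitely many
  subsets \<open>d\<close>. They split the part of \<open>X\<close> living off \<open>S\<close> into
  finitely many pieces according to which \<open>d\<close> is absorbed, and
  \<open>large_partition\<close> makes one piece large.\<close>

lemma large_step:
  assumes D: "disjoint_collection D" and X: "large X D"
  shows "\<exists>d\<in>FU D. \<exists>D'. disjoint_collection D' \<and> D' \<subseteq> FU D \<and> (\<forall>e\<in>D'. e \<inter> d = {}) \<and>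
    large {z\<in>X. d \<union> z \<in> X} D'"
proof -
  obtain S where S: "finite S"
    and absorb: "\<forall>z\<in>FU D. z \<inter> S = {} \<longrightarrow> (\<exists>d\<in>FU D. d \<subseteq> S \<and> d \<union> z \<in> X)"
    using large_absorbing[OF assms] by (elim exE conjE)
  \<comment> \<open>Discarding the sets that meet \<open>S\<close> makes \<open>absorb\<close>
    applicable to all of \<open>FU D1\<close> and keeps later sets disjoint from whichever
    \<open>d\<close> inside \<open>S\<close> is selected.\<close>
  define D1 where "D1 = {d\<in>D. d \<inter> S = {}}"
  have D1: "disjoint_collection D1" unfolding D1_def by (rule disjoint_collection_away[OF D S])
  have sub: "D1 \<subseteq> D" by (auto simp: D1_def)
  have away: "z \<inter> S = {}" if "z \<in> FU D1" for z
    using that by (rule FU_disjoint_from) (auto simp: D1_def)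
  have "X \<inter> FU D1 \<subseteq> (\<Union>d\<in>{d\<in>FU D. d \<subseteq> S}. {z\<in>X. d \<union> z \<in> X})"
  proof
    fix z assume z: "z \<in> X \<inter> FU D1"
    then have "z \<in> FU D" "z \<inter> S = {}" using away FU_mono[OF sub] by auto
    then obtain d where "d \<in> FU D" "d \<subseteq> S" "d \<union> z \<in> X" using absorb by blast
    then show "z \<in> (\<Union>d\<in>{d\<in>FU D. d \<subseteq> S}. {z\<in>X. d \<union> z \<in> X})" using z by blast
  qed
  moreover have "finite {d\<in>FU D. d \<subseteq> S}" using S by simp
  ultimately have "\<exists>d\<in>{d\<in>FU D. d \<subseteq> S}. \<exists>D'. disjoint_collection D' \<and> D' \<subseteq> FU D1 \<and>
      large {z\<in>X. d \<union> z \<in> X} D'"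
    by (intro large_partition[OF _ D1 large_mono[OF X order_trans[OF sub subset_FU]]])
  then obtain d D' where d: "d \<in> FU D" "d \<subseteq> S"
    and D': "disjoint_collection D'" "D' \<subseteq> FU D1" "large {z\<in>X. d \<union> z \<in> X} D'"
    by blast
  have "\<forall>e\<in>D'. e \<inter> d = {}" using away D'(2) d(2) by blast
  then show ?thesis using d(1) D' FU_mono[OF sub] by blast
qed

text \<open>
  Baumgartner's argument: iterating \<open>large_step\<close> gives sets \<open>d n\<close> and shrinking large families
  \<open>Z n\<close> such that adjoining any union of \<open>d 0, \<dots>, d (n - 1)\<close> to a member of \<open>Z n\<close> stays in \<open>X\<close>.
  The \<open>d n\<close> themselves need not be in \<open>X\<close>; the greedy choice among their unions repairs this.
\<close>

lemma large_contains_FU: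
  fixes D :: "'a set set"
  assumes D: "disjoint_collection D" and X: "large X D"
  shows "\<exists>D'. disjoint_collection D' \<and> D' \<subseteq> FU D \<and> FU D' \<subseteq> X"
proof -
  \<comment> \<open>A state consists of the chosen set, the current collection and the current
    family. \<open>Inv\<close> also records that a suitable refinement exists for this chosen set,
    so that every state has a successor in the sense of \<open>Step\<close>.\<close>
  define Inv where "Inv = (\<lambda>(d, D, X :: 'a set set). d \<in> FU D \<and> disjoint_collection D \<and> large X D \<and>
      (\<exists>D'. disjoint_collection D' \<and> D' \<subseteq> FU D \<and> (\<forall>e\<in>D'. e \<inter> d = {}) \<and>
         large {z\<in>X. d \<union> z \<in> X} D'))"
  define Step where "Step = (\<lambda>(d :: 'a set, D, X) (d' :: 'a set, D', X' :: 'a set set).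
      D' \<subseteq> FU D \<and> (\<forall>e\<in>D'. e \<inter> d = {}) \<and> X' = {z\<in>X. d \<union> z \<in> X})"
  have Inv_ex: "\<exists>d. Inv (d, D, X)" if "disjoint_collection D" "large X D" for D X
  proof -
    from large_step[OF that] obtain d D' where "d \<in> FU D" "disjoint_collection D'" "D' \<subseteq> FU D"
      "\<forall>e\<in>D'. e \<inter> d = {}" "large {z\<in>X. d \<union> z \<in> X} D'" by blast
    with that have "Inv (d, D, X)" unfolding Inv_def prod.case by blast
    then show ?thesis by blast
  qed
  obtain d0 where d0: "Inv (d0, D, X)" using Inv_ex[OF D X] by blast
  obtain f where f: "\<And>n. Inv (f n)" "\<And>n. Step (f n) (f (Suc n))" and f0: "f 0 = (d0, D, X)"
  proof -
    \<comment> \<open>The index in \<open>R\<close> pins the initial state, so that the sequence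
      given by dependent choice starts with \<open>D\<close> and \<open>X\<close>.\<close>
    define R where "R n t \<longleftrightarrow> Inv t \<and> (n = 0 \<longrightarrow> t = (d0, D, X))" for n :: nat and t
    have "\<exists>t. R 0 t" using d0 unfolding R_def by blast
    moreover have "\<exists>t'. R (Suc n) t' \<and> Step t t'" if "R n t" for n t
    proof -
      obtain d E Z where [simp]: "t = (d, E, Z)" by (cases t)
      from that obtain D' where D': "disjoint_collection D'" "D' \<subseteq> FU E" "\<forall>e\<in>D'. e \<inter> d = {}"
         "large {z\<in>Z. d \<union> z \<in> Z} D'" unfolding R_def Inv_def by (simp only: \<open>t = (d, E, Z)\<close> prod.case) blast
      from Inv_ex[OF D'(1,4)] obtain d' where "Inv (d', D', {z\<in>Z. d \<union> z \<in> Z})" by blast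
      moreover have "Step t (d', D', {z\<in>Z. d \<union> z \<in> Z})"
        using D' by (simp add: Step_def)
      ultimately show ?thesis unfolding R_def by blast
    qed
    ultimately obtain f where "\<forall>n. R n (f n) \<and> Step (f n) (f (Suc n))"
      using dependent_nat_choice[of R "\<lambda>_. Step"] by blast
    then show ?thesis using that unfolding R_def by blast
  qed
  define d where "d n = fst (f n)" for n
  define E where "E n = fst (snd (f n))" for n
  define Z where "Z n = snd (snd (f n))" for n
  have E0: "E 0 = D" and Z0: "Z 0 = X" by (simp_all add: E_def Z_def f0)
  have dE: "d n \<in> FU (E n)" and dc: "disjoint_collection (E n)" and lg: "large (Z n) (E n)" for n
    using f(1)[of n] by (auto simp: Inv_def d_def E_def Z_def split: prod.splits)
  have ES: "E (Suc n) \<subseteq> FU (E n)" and Ed: "\<And>e. e \<in> E (Suc n) \<Longrightarrow> e \<inter> d n = {}"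
    and ZS: "Z (Suc n) = {z\<in>Z n. d n \<union> z \<in> Z n}" for n
    using f(2)[of n] by (auto simp: Step_def d_def E_def Z_def split: prod.splits)
  have E_anti: "FU (E n) \<subseteq> FU (E m)" if "m \<le> n" for m n
    using that by (induction n rule: dec_induct) (use FU_subset_FU[OF ES] in blast)+
  have d_dis: "d m \<inter> d n = {}" if "m < n" for m n
  proof -
    have "d n \<in> FU (E (Suc m))" using dE E_anti[of "Suc m" n] that by auto
    then have "d n \<inter> d m = {}" by (rule FU_disjoint_from) (rule Ed)
    then show ?thesis by blast
  qed
  have d_nonempty: "finite (d n) \<and> d n \<noteq> {}" for n
    using finite_nonempty_FU[OF dc dE] .
  have dcd: "disjoint_collection (range d)"
    by (rule disjoint_collection_range[OF d_nonempty d_dis])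
  have tail: "disjoint_collection (d ` {n..})" for n
  proof -
    have "disjoint_collection (range (\<lambda>m. d (n + m)))"
      by (rule disjoint_collection_range) (auto simp: d_nonempty d_dis)
    moreover have "range (\<lambda>m. d (n + m)) = d ` {n..}"
      by (auto simp: image_iff) (metis le_Suc_ex)
    ultimately show ?thesis by simp
  qed
  \<comment> \<open>For \<open>z\<close> in \<open>Z (Suc n)\<close> both \<open>z\<close> and
    \<open>d n \<union> z\<close> are in \<open>Z n\<close>. The induction hypothesis is applied to
    the second if \<open>n\<close> belongs to \<open>I\<close>, and to the first otherwise.\<close>
  have absorb: "z \<in> X \<and> (\<forall>I. I \<subseteq> {..<n} \<longrightarrow> \<Union>(d ` I) \<union> z \<in> X)" if "z \<in> Z n" for z n
    using that
  proof (induction n arbitrary: z)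
    case 0
    then show ?case by (auto simp: Z0)
  next
    case (Suc n)
    then have z: "z \<in> Z n" "d n \<union> z \<in> Z n" by (auto simp: ZS)
    have "\<Union>(d ` I) \<union> z \<in> X" if "I \<subseteq> {..<Suc n}" for I
    proof (cases "n \<in> I")
      case True
      have "I - {n} \<subseteq> {..<n}" using that by auto
      then have "\<Union>(d ` (I - {n})) \<union> (d n \<union> z) \<in> X" using Suc.IH[OF z(2)] by blast
      moreover have "\<Union>(d ` (I - {n})) \<union> (d n \<union> z) = \<Union>(d ` I) \<union> z" using True by auto
      ultimately show ?thesis by simp
    next
      case False
      then have "I \<subseteq> {..<n}" using that by (auto simp: less_Suc_eq)
      then show ?thesis using Suc.IH[OF z(1)] by blast
    qed
    then show ?case using Suc.IH[OF z(1)] by blast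
  qed
  have "\<exists>y\<in>FU (range d). y \<inter> S = {} \<and>
      (\<forall>u. u \<subseteq> S \<longrightarrow> u \<in> insert {} (FU (range d)) \<longrightarrow> u \<union> y \<in> X)" if "finite S" for S
  proof -
    have "finite {i. d i \<inter> S \<noteq> {}}"
    proof -
      have "finite {i. s \<in> d i}" for s
      proof (cases "\<exists>i. s \<in> d i")
        case True
        then obtain i where "s \<in> d i" by blast
        then have "{i. s \<in> d i} \<subseteq> {i}" using d_dis by (auto) (metis disjoint_iff linorder_neqE_nat)
        then show ?thesis using finite_subset by blast
      qed auto
      moreover have "{i. d i \<inter> S \<noteq> {}} = (\<Union>s\<in>S. {i. s \<in> d i})" by blast
      ultimately show ?thesis using that by auto
    qed
    then obtain n where n: "\<And>i. d i \<inter> S \<noteq> {} \<Longrightarrow> i < n"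
      using finite_nat_set_iff_bounded by auto
    \<comment> \<open>The sets \<open>d i\<close> with \<open>i \<ge> n\<close> avoid
      \<open>S\<close> and form a disjoint collection inside \<open>FU (E n)\<close>. As
      \<open>Z n\<close> is large for \<open>E n\<close>, it contains a finite union of them, which
      serves as the next block.\<close>
    have "d ` {n..} \<subseteq> FU (E n)" using dE E_anti by auto
    then obtain y where y: "y \<in> Z n" "y \<in> FU (d ` {n..})"
      using lg[of n] tail[of n] unfolding large_def by blast
    have "y \<inter> S = {}"
      using y(2) by (rule FU_disjoint_from) (use n in force)
    moreover have "y \<in> FU (range d)" using y(2) FU_mono[of "d ` {n..}" "range d"] by blast
    moreover have "u \<union> y \<in> X" if u: "u \<subseteq> S" "u \<in> insert {} (FU (range d))" for u
    proof -
      obtain I where I: "u = \<Union>(d ` I)"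
      proof (cases "u = {}")
        case False
        then show ?thesis using that u(2) unfolding FU_def by (auto simp: subset_image_iff)
      qed (use that[of "{}"] in simp)
      \<comment> \<open>A nonempty \<open>d i\<close> contained in \<open>S\<close> meets
        \<open>S\<close>, so its index is below \<open>n\<close> and \<open>absorb\<close> covers
        it.\<close>
      have "I \<subseteq> {..<n}" using u(1) I d_nonempty n by fastforce
      then show ?thesis using absorb[OF y(1)] I by blast
    qed
    ultimately show ?thesis by blast
  qed
  from greedy_disjoint_collection[OF dcd this] obtain D'
    where "disjoint_collection D'" "D' \<subseteq> FU (range d)" "FU D' \<subseteq> X" by blast
  moreover have "range d \<subseteq> FU D" using dE E_anti[of 0] E0 by auto
  ultimately show ?thesis using FU_subset_FU by blast
qed

text \<open>Since \<open>UNIV\<close> is large, one of the two color classes is large for some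
  refinement of \<open>D\<close>, and a large family contains all finite unions of a further
  refinement.\<close>

theorem hindman:
  assumes D: "disjoint_collection D"
  shows "\<exists>D'. disjoint_collection D' \<and> D' \<subseteq> FU D \<and>
    ((\<forall>u\<in>FU D'. c u) \<or> (\<forall>u\<in>FU D'. \<not> c u))"
proof -
  have "large UNIV D"
    unfolding large_def disjoint_collection_def using subset_FU by (metis Int_UNIV_left finite.emptyI subset_empty)
  moreover have "UNIV \<inter> FU D \<subseteq> (\<Union>b\<in>UNIV. {u. c u = b})" by auto
  ultimately obtain b D1 where D1: "disjoint_collection D1" "D1 \<subseteq> FU D" "large {u. c u = b} D1"
    using large_partition[OF finite_UNIV D] by (metis (no_types, lifting))
  from large_contains_FU[OF D1(1,3)] obtain D'
    where "disjoint_collection D'" "D' \<subseteq> FU D1" "FU D' \<subseteq> {u. c u = b}" by blast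
  then show ?thesis using FU_subset_FU[OF D1(2)] by (cases b) blast+
qed

section \<open>Sets in the universe and the action of permutations\<close>

context zfa
begin

definition elems :: "'v \<Rightarrow> 'v set" where
  "elems x = {y. y \<^bold>\<in> x}"

lemma mem_elems [simp]: "y \<in> elems x \<longleftrightarrow> y \<^bold>\<in> x"
  by (simp add: elems_def)

lemma set_eqI: "\<not> atom x \<Longrightarrow> \<not> atom y \<Longrightarrow> elems x = elems y \<Longrightarrow> x = y"
  using extensionality by (simp add: elems_def set_eq_iff)

text \<open>Pairing and union adjoin one element at a time. This makes \<open>set_of\<close>
  meaningful on all finite HOL sets.\<close>

lemma finite_set_exists:
  assumes "finite S"
  shows "\<exists>x. \<not> atom x \<and> elems x = S"
  using assms
proof induction
  case empty
  \<comment> \<open>Separation by a false property yields an empty set from any object;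
    \<open>undefined\<close> is an arbitrary choice.\<close>
  obtain u :: 'v where "\<not> atom u \<and> (\<forall>z. z \<^bold>\<in> u \<longleftrightarrow> z \<^bold>\<in> undefined \<and> False)"
    using separation[of undefined "\<lambda>_. False"] by blast
  then show ?case by (auto simp: elems_def)
next
  case (insert a S)
  then obtain x where x: "\<not> atom x" "elems x = S" by blast
  obtain s where s: "\<And>z. z \<^bold>\<in> s \<longleftrightarrow> z = a" using pairing[of a a] by auto
  obtain p where p: "\<And>z. z \<^bold>\<in> p \<longleftrightarrow> z = s \<or> z = x" using pairing[of s x] by auto
  obtain u where "\<not> atom u" "\<And>z. z \<^bold>\<in> u \<longleftrightarrow> (\<exists>y. y \<^bold>\<in> p \<and> z \<^bold>\<in> y)"
    using union[of p] by auto
  then have "\<not> atom u \<and> elems u = insert a S" using x s p by (auto simp: elems_def)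
  then show ?case by blast
qed

lemma set_of_elems: "\<not> atom x \<Longrightarrow> set_of (elems x) = x"
  by (rule set_of_mem) auto

lemma
  assumes "finite S"
  shows not_atom_set_of: "\<not> atom (set_of S)" and elems_set_of: "elems (set_of S) = S"
proof -
  obtain x where "\<not> atom x" "elems x = S" using finite_set_exists[OF assms] by blast
  moreover from this have "set_of S = x" using set_of_elems[of x] by simp
  ultimately show "\<not> atom (set_of S)" "elems (set_of S) = S" by simp_all
qed

lemma mem_set_of [simp]: "finite S \<Longrightarrow> x \<^bold>\<in> set_of S \<longleftrightarrow> x \<in> S"
  by (simp add: elems_set_of flip: mem_elems)

lemma elems_act: "\<not> atom x \<Longrightarrow> elems (act \<pi> x) = act \<pi> ` elems x"
  using mem_act by (auto simp: elems_def)

lemma act_set_of: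
  assumes "finite S"
  shows "act \<pi> (set_of S) = set_of (act \<pi> ` S)"
  using assms by (intro set_eqI) (auto simp: act_not_atom not_atom_set_of elems_act elems_set_of)

lemma mem_induct: "(\<And>x. (\<And>y. y \<^bold>\<in> x \<Longrightarrow> Q y) \<Longrightarrow> Q x) \<Longrightarrow> Q x"
  using wf_induct[OF wf_mem, of Q x] by blast

lemma act_id: "act id x = x"
proof (induction x rule: mem_induct)
  case (1 x)
  show ?case
  proof (cases "atom x")
    case False
    then show ?thesis using 1 by (intro set_eqI) (auto simp: act_not_atom elems_act)
  qed (simp add: act_atom)
qed

text \<open>The hypothesis guarantees that \<open>act \<sigma> a\<close> is again an atom for an
  atom \<open>a\<close>, so that \<open>act \<pi>\<close> acts on it as \<open>\<pi>\<close>. Sets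
  follow by induction on membership.\<close>

lemma act_comp:
  assumes "\<And>a. atom a \<Longrightarrow> atom (\<sigma> a)"
  shows "act (\<pi> \<circ> \<sigma>) x = act \<pi> (act \<sigma> x)"
proof (induction x rule: mem_induct)
  case (1 x)
  show ?case
  proof (cases "atom x")
    case False
    have "act (\<pi> \<circ> \<sigma>) ` elems x = act \<pi> ` act \<sigma> ` elems x"
      unfolding image_image by (intro image_cong refl 1) simp
    then have "elems (act (\<pi> \<circ> \<sigma>) x) = elems (act \<pi> (act \<sigma> x))"
      unfolding elems_act[OF False] elems_act[OF act_not_atom[OF False]] .
    with False show ?thesis by (intro set_eqI act_not_atom)
  qed (simp add: act_atom assms)
qed

section \<open>Von Neumann natural numbers and Kuratowski pairs\<close>

fun num :: "nat \<Rightarrow> 'v" where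
  "num 0 = set_of {}"
| "num (Suc n) = set_of (insert (num n) (elems (num n)))"

lemma num: "\<not> atom (num n) \<and> elems (num n) = num ` {..<n}"
  by (induction n) (simp_all add: not_atom_set_of elems_set_of lessThan_Suc)

declare num.simps [simp del]

lemma mem_num [simp]: "z \<^bold>\<in> num n \<longleftrightarrow> (\<exists>i<n. z = num i)"
  using num[of n] by (auto simp: set_eq_iff image_iff)

lemma num_less_neq: "m < n \<Longrightarrow> num m \<noteq> num n"
proof
  assume "m < n" "num m = num n"
  moreover from \<open>m < n\<close> have "num m \<^bold>\<in> num n" by auto
  ultimately show False using mem_asym[of "num m" "num n"] by simp
qed

lemma inj_num: "inj num"
  by (rule injI) (metis num_less_neq linorder_neqE_nat)

definition opair :: "'v \<Rightarrow> 'v \<Rightarrow> 'v" where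
  "opair x y = set_of {set_of {x}, set_of {x, y}}"

end

section \<open>Orbits in the Second Fraenkel Model\<close>

context second_fraenkel
begin

section \<open>Closure properties of the hereditarily symmetric objects\<close>

lemma N2_mem: "x \<in> N2 \<Longrightarrow> y \<^bold>\<in> x \<Longrightarrow> y \<in> N2"
  unfolding N2_def by (auto intro: rtranclp.rtrancl_into_rtrancl)

lemma N2_I: "symmetric x \<Longrightarrow> elems x \<subseteq> N2 \<Longrightarrow> x \<in> N2"
  unfolding N2_def by (auto elim!: rtranclp.cases[of _ _ x])

lemma N2_symmetric: "x \<in> N2 \<Longrightarrow> symmetric x"
  unfolding N2_def by blast

lemma finite_P: "finite (P n)"
  using card_P[of n] by (simp add: card_ge_0_finite)

text \<open>Fixing each element is stronger than fixing \<open>x\<close> as a whole, but it holds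
  for the sets that must be shown symmetric here: finite sets, the set of natural numbers and the
  final collection \<open>Y\<close>.\<close>

lemma symmetric_if_elems_fixed:
  assumes "\<not> atom x" "finite E" "E \<subseteq> {a. atom a}"
    and "\<And>\<pi> y. \<pi> \<in> pointwise_stabilizer E \<Longrightarrow> y \<^bold>\<in> x \<Longrightarrow> act \<pi> y = y"
  shows "symmetric x"
proof -
  have "act \<pi> x = x" if "\<pi> \<in> pointwise_stabilizer E" for \<pi>
    using assms(1) assms(4)[OF that] by (intro set_eqI) (auto simp: act_not_atom elems_act)
  then have "pointwise_stabilizer E \<subseteq> stabilizer x"
    by (auto simp: stabilizer_def pointwise_stabilizer_def)
  then show ?thesis using assms(2,3) unfolding symmetric_def by blast
qed

text \<open>The union of finitely many finite supports is a finite common support.\<close>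

lemma set_of_N2:
  assumes "finite S" "S \<subseteq> N2"
  shows "set_of S \<in> N2"
proof (rule N2_I)
  have "\<exists>E. \<forall>y\<in>S. finite (E y) \<and> E y \<subseteq> {a. atom a} \<and> pointwise_stabilizer (E y) \<subseteq> stabilizer y"
    using assms(2) N2_symmetric unfolding symmetric_def by (intro bchoice) blast
  then obtain E where "\<forall>y\<in>S.
      finite (E y) \<and> E y \<subseteq> {a. atom a} \<and> pointwise_stabilizer (E y) \<subseteq> stabilizer y" by (rule exE)
  note E = bspec[OF this]
  show "symmetric (set_of S)"
  proof (rule symmetric_if_elems_fixed[of _ "\<Union>(E ` S)"])
    show "finite (\<Union>(E ` S))" "\<Union>(E ` S) \<subseteq> {a. atom a}" using assms(1) E by blast+
    fix \<pi> y assume \<pi>: "\<pi> \<in> pointwise_stabilizer (\<Union>(E ` S))" and "y \<^bold>\<in> set_of S"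
    then have y: "y \<in> S" using assms(1) by simp
    then have "\<pi> \<in> pointwise_stabilizer (E y)" using \<pi> unfolding pointwise_stabilizer_def by blast
    then show "act \<pi> y = y" using E[OF y] unfolding stabilizer_def by blast
  qed (use assms in \<open>auto simp: not_atom_set_of\<close>)
  show "elems (set_of S) \<subseteq> N2" using assms by (simp add: elems_set_of)
qed

lemma num_N2: "num n \<in> N2"
proof (induction n rule: less_induct)
  case (less n)
  have "set_of (elems (num n)) \<in> N2"
    using less num[of n] by (intro set_of_N2) auto
  then show ?case using set_of_elems[of "num n"] num[of n] by metis
qed

lemma act_num: "act \<pi> (num n) = num n"
proof (induction n rule: less_induct)
  case (less n)
  then have "act \<pi> ` num ` {..<n} = num ` {..<n}"
    unfolding image_image by (intro image_cong) simp_all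
  then show ?case using num[of n]
    by (intro set_eqI) (simp_all add: act_not_atom elems_act)
qed

lemma opair_N2: "x \<in> N2 \<Longrightarrow> y \<in> N2 \<Longrightarrow> opair x y \<in> N2"
  unfolding opair_def by (intro set_of_N2) (auto intro!: set_of_N2)

section \<open>Pointwise stabilizers as groups, and their orbits\<close>

lemma pointwise_stabilizer_props:
  assumes "\<pi> \<in> pointwise_stabilizer E"
  shows "\<And>a. atom a \<Longrightarrow> atom (\<pi> a)" "inv \<pi> \<in> pointwise_stabilizer E" "inv \<pi> \<circ> \<pi> = id" "\<pi> \<circ> inv \<pi> = id"
proof -
  have p: "\<pi> permutes {a. atom a}" and P: "\<And>n. \<pi> ` P n = P n" and E: "\<And>a. a \<in> E \<Longrightarrow> \<pi> a = a"
    using assms unfolding pointwise_stabilizer_def G_def by auto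
  note pi = permutes_inv[OF p]
  show "\<And>a. atom a \<Longrightarrow> atom (\<pi> a)" using permutes_in_image[OF p] by simp
  show "inv \<pi> \<circ> \<pi> = id" "\<pi> \<circ> inv \<pi> = id" using permutes_inv_o[OF p] by auto
  have "inv \<pi> ` P n = P n" for n
    using P[of n] permutes_inj[OF p] by (metis image_inv_f_f)
  then have "inv \<pi> \<in> G" using pi unfolding G_def by blast
  moreover have "inv \<pi> a = a" if "a \<in> E" for a
    using E[OF that] permutes_inj[OF p] by (metis inv_f_f)
  ultimately show "inv \<pi> \<in> pointwise_stabilizer E" unfolding pointwise_stabilizer_def by blast
qed

lemma pointwise_stabilizer_comp:
  assumes "\<pi> \<in> pointwise_stabilizer E" "\<sigma> \<in> pointwise_stabilizer E"
  shows "\<pi> \<circ> \<sigma> \<in> pointwise_stabilizer E"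
proof -
  have "\<pi> \<circ> \<sigma> permutes {a. atom a}"
    using assms by (intro permutes_compose) (auto simp: pointwise_stabilizer_def G_def)
  moreover have "(\<pi> \<circ> \<sigma>) ` P n = P n" for n
    using assms unfolding image_comp[symmetric] by (simp add: pointwise_stabilizer_def G_def)
  ultimately show ?thesis using assms by (simp add: pointwise_stabilizer_def G_def)
qed

lemma act_comp_stabilizer:
  "\<sigma> \<in> pointwise_stabilizer E \<Longrightarrow> act (\<pi> \<circ> \<sigma>) x = act \<pi> (act \<sigma> x)"
  using act_comp pointwise_stabilizer_props(1) by blast

lemma id_in_pointwise_stabilizer: "id \<in> pointwise_stabilizer E"
  unfolding pointwise_stabilizer_def G_def by (auto simp: permutes_id)

definition orbit :: "'v set \<Rightarrow> 'v \<Rightarrow> 'v set" where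
  "orbit E x = (\<lambda>\<pi>. act \<pi> x) ` pointwise_stabilizer E"

lemma self_in_orbit: "x \<in> orbit E x"
  unfolding orbit_def using id_in_pointwise_stabilizer act_id by (metis imageI)

lemma orbit_act_subset:
  assumes "\<pi> \<in> pointwise_stabilizer E"
  shows "orbit E (act \<pi> x) \<subseteq> orbit E x"
  unfolding orbit_def
  using assms pointwise_stabilizer_comp act_comp_stabilizer by (auto simp: image_iff) metis

lemma orbit_act:
  assumes "\<pi> \<in> pointwise_stabilizer E"
  shows "orbit E (act \<pi> x) = orbit E x"
proof
  have "act (inv \<pi>) (act \<pi> x) = x"
    using act_comp_stabilizer[OF assms, of "inv \<pi>" x] pointwise_stabilizer_props(3)[OF assms]
    by (simp add: act_id)
  then show "orbit E x \<subseteq> orbit E (act \<pi> x)"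
    using orbit_act_subset[OF pointwise_stabilizer_props(2)[OF assms], of "act \<pi> x"] by simp
qed (rule orbit_act_subset[OF assms])

lemma orbit_eq: "y \<in> orbit E x \<Longrightarrow> orbit E y = orbit E x"
  using orbit_act by (auto simp: orbit_def[of E x])

text \<open>Every element of the stabilizer maps the orbit into itself. Using this for
  \<open>inv \<pi>\<close> as well gives the reverse inclusion.\<close>

lemma act_image_orbit:
  assumes "\<pi> \<in> pointwise_stabilizer E"
  shows "act \<pi> ` orbit E x = orbit E x"
proof -
  have *: "act \<sigma> ` orbit E x \<subseteq> orbit E x" if "\<sigma> \<in> pointwise_stabilizer E" for \<sigma>
    using pointwise_stabilizer_comp[OF that] act_comp_stabilizer[of _ E \<sigma> x, symmetric]
    unfolding orbit_def by auto
  have "act \<pi> ` act (inv \<pi>) ` orbit E x = orbit E x"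
    using act_comp_stabilizer[OF pointwise_stabilizer_props(2)[OF assms], of \<pi>]
      pointwise_stabilizer_props(4)[OF assms]
    by (simp add: image_image act_id flip: act_comp_stabilizer)
  then show ?thesis using *[OF assms] *[OF pointwise_stabilizer_props(2)[OF assms]] by blast
qed

lemma finite_orbit:
  assumes "x \<in> N2"
  shows "finite (orbit E x)"
proof -
  obtain E' where E': "finite E'" "E' \<subseteq> {a. atom a}" "pointwise_stabilizer E' \<subseteq> stabilizer x"
    using N2_symmetric[OF assms] unfolding symmetric_def by blast
  then obtain k where k: "\<And>a. a \<in> E' \<Longrightarrow> a \<in> P (k a)"
    using atoms_P by (metis UN_E subsetD)
  \<comment> \<open>\<open>r \<pi>\<close> is the graph of \<open>\<pi>\<close> restricted to the
    support \<open>E'\<close> of \<open>x\<close>. It is a set of pairs, so finitely many values can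
    be counted inside a finite power set.\<close>
  define r where "r \<pi> = (\<lambda>a. (a, \<pi> a)) ` E'" for \<pi> :: "'v \<Rightarrow> 'v"
  \<comment> \<open>If the restrictions agree, \<open>inv \<sigma> \<circ> \<pi>\<close> fixes
    \<open>E'\<close> pointwise and therefore fixes \<open>x\<close>; applying
    \<open>\<sigma>\<close> gives the equality.\<close>
  have eq: "act \<pi> x = act \<sigma> x"
    if \<pi>: "\<pi> \<in> pointwise_stabilizer E" and \<sigma>: "\<sigma> \<in> pointwise_stabilizer E" and "r \<pi> = r \<sigma>" for \<pi> \<sigma>
  proof -
    have agree: "\<pi> a = \<sigma> a" if "a \<in> E'" for a using \<open>r \<pi> = r \<sigma>\<close> that unfolding r_def by blast
    note s = pointwise_stabilizer_props[OF \<sigma>]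
    have inE: "inv \<sigma> \<circ> \<pi> \<in> pointwise_stabilizer E" by (rule pointwise_stabilizer_comp[OF s(2) \<pi>])
    have "(inv \<sigma> \<circ> \<pi>) a = a" if "a \<in> E'" for a
      using agree[OF that] s(3) by (simp add: fun_eq_iff)
    then have "inv \<sigma> \<circ> \<pi> \<in> pointwise_stabilizer E'"
      using inE unfolding pointwise_stabilizer_def by blast
    then have fixed: "act (inv \<sigma> \<circ> \<pi>) x = x" using E'(3) unfolding stabilizer_def by blast
    have "\<pi> = \<sigma> \<circ> (inv \<sigma> \<circ> \<pi>)" using s(4) by (simp add: o_assoc)
    then have "act \<pi> x = act \<sigma> (act (inv \<sigma> \<circ> \<pi>) x)" using act_comp_stabilizer[OF inE] by metis
    then show ?thesis using fixed by simp
  qed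
  have "r ` pointwise_stabilizer E \<subseteq> Pow (Sigma E' (\<lambda>a. P (k a)))"
  proof (intro subsetI, elim imageE)
    fix g \<pi> assume g: "g = r \<pi>" and "\<pi> \<in> pointwise_stabilizer E"
    then have "\<pi> ` P n = P n" for n unfolding pointwise_stabilizer_def G_def by simp
    then have "\<pi> a \<in> P (k a)" if "a \<in> E'" for a using k[OF that] by (metis imageI)
    then show "g \<in> Pow (Sigma E' (\<lambda>a. P (k a)))" unfolding g r_def by auto
  qed
  moreover have "finite (Pow (Sigma E' (\<lambda>a. P (k a))))" using E'(1) finite_P by simp
  ultimately have "finite (r ` pointwise_stabilizer E)" by (rule finite_subset)
  \<comment> \<open>One representative permutation for each restriction exhibits the orbit as an
    image of a finite set.\<close>
  moreover have "orbit E x = (\<lambda>g. act (SOME \<pi>. \<pi> \<in> pointwise_stabilizer E \<and> r \<pi> = g) x) ` r ` pointwise_stabilizer E"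
    unfolding orbit_def image_image
  proof (rule image_cong[OF refl])
    fix \<pi> assume \<pi>: "\<pi> \<in> pointwise_stabilizer E"
    define \<sigma> where "\<sigma> = (SOME \<sigma>. \<sigma> \<in> pointwise_stabilizer E \<and> r \<sigma> = r \<pi>)"
    have "\<sigma> \<in> pointwise_stabilizer E \<and> r \<sigma> = r \<pi>" unfolding \<sigma>_def by (rule someI[of _ \<pi>]) (simp add: \<pi>)
    then have "act \<pi> x = act \<sigma> x" by (intro eq[OF \<pi>]) simp_all
    then show "act \<pi> x = act (SOME \<sigma>. \<sigma> \<in> pointwise_stabilizer E \<and> r \<sigma> = r \<pi>) x"
      unfolding \<sigma>_def .
  qed
  ultimately show ?thesis by simp
qed


section \<open>Pair injectivity and the set of natural numbers in the model\<close>

lemma set_of_eq_iff: "finite S \<Longrightarrow> finite T \<Longrightarrow> set_of S = set_of T \<longleftrightarrow> S = T"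
  using elems_set_of by metis

lemma opair_inject: "opair x y = opair x' y' \<longleftrightarrow> x = x' \<and> y = y'"
  by (auto simp: opair_def set_of_eq_iff doubleton_eq_iff)

text \<open>An inductive set of the universe contains every \<open>num n\<close>, so Separation cuts
  out exactly the numbers. All permutations fix them, so the empty support suffices.\<close>

lemma omega_N2: "\<exists>I\<in>N2. \<not> atom I \<and> elems I = range num"
proof -
  obtain I e where e: "e \<^bold>\<in> I" "\<not> atom e" "\<And>z. \<not> z \<^bold>\<in> e"
    and I: "\<And>x. x \<^bold>\<in> I \<Longrightarrow> \<exists>y. y \<^bold>\<in> I \<and> (\<forall>z. z \<^bold>\<in> y \<longleftrightarrow> z \<^bold>\<in> x \<or> z = x)"
    using infinity by blast
  have "num n \<^bold>\<in> I" for n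
  proof (induction n)
    case 0
    have "e = num 0" using e num[of 0] by (intro set_eqI) (auto simp: elems_def)
    then show ?case using e(1) by simp
  next
    case (Suc n)
    then obtain y where y: "y \<^bold>\<in> I" "\<And>z. z \<^bold>\<in> y \<longleftrightarrow> z \<^bold>\<in> num n \<or> z = num n" using I by blast
    have "elems y = elems (num (Suc n))"
      using y(2) by (auto simp: set_eq_iff less_Suc_eq)
    moreover have "\<not> atom y" using y(2) atom_no_elements by blast
    ultimately have "y = num (Suc n)" using num[of "Suc n"] by (intro set_eqI) simp_all
    then show ?case using y(1) by simp
  qed
  moreover obtain W where W: "\<not> atom W" "\<And>z. z \<^bold>\<in> W \<longleftrightarrow> z \<^bold>\<in> I \<and> z \<in> range num"
    using separation[of I "\<lambda>z. z \<in> range num"] by blast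
  ultimately have eW: "elems W = range num" by (auto simp: set_eq_iff)
  have "symmetric W"
    by (rule symmetric_if_elems_fixed[of _ "{}"]) (use W act_num in auto)
  then have "W \<in> N2" using eW num_N2 by (intro N2_I) auto
  then show ?thesis using W(1) eW by blast
qed

section \<open>Absoluteness of pairs, numbers, functions and finiteness for the model\<close>

interpretation M: set_structure N2 mem atom .

text \<open>\<open>N2\<close> is transitive, so quantifiers bounded by \<open>N2\<close> already see
  every element of \<open>u\<close>. The same reason underlies the characterizations of successors
  and of the empty set.\<close>

lemma is_upair_iff:
  assumes "u \<in> N2" "x \<in> N2" "y \<in> N2"
  shows "M.is_upair u x y \<longleftrightarrow> u = set_of {x, y}"
proof -
  have "M.is_upair u x y \<longleftrightarrow> \<not> atom u \<and> elems u = {x, y}"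
    using assms N2_mem unfolding M.is_upair_def M.is_set_def by (auto simp: set_eq_iff)
  also have "\<dots> \<longleftrightarrow> u = set_of {x, y}"
    using not_atom_set_of[of "{x, y}"] elems_set_of[of "{x, y}"] set_of_elems[of u] by auto
  finally show ?thesis .
qed

lemma is_opair_iff:
  assumes "p \<in> N2" "x \<in> N2" "y \<in> N2"
  shows "M.is_opair p x y \<longleftrightarrow> p = opair x y"
proof -
  have *: "set_of {x, x} \<in> N2" "set_of {x, y} \<in> N2" using assms by (auto intro: set_of_N2)
  have "M.is_opair p x y \<longleftrightarrow> M.is_upair p (set_of {x, x}) (set_of {x, y})"
    unfolding M.is_opair_def using * is_upair_iff assms by metis
  also have "\<dots> \<longleftrightarrow> p = opair x y"
    using is_upair_iff[OF assms(1) *] by (simp add: opair_def)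
  finally show ?thesis .
qed

lemma maps_to_iff:
  assumes "x \<in> N2" "y \<in> N2"
  shows "M.maps_to f x y \<longleftrightarrow> opair x y \<^bold>\<in> f"
  unfolding M.maps_to_def using is_opair_iff assms opair_N2 by metis

lemma is_succ_iff:
  assumes "x \<in> N2" "y \<in> N2"
  shows "M.is_succ y x \<longleftrightarrow> \<not> atom y \<and> elems y = insert x (elems x)"
  using assms N2_mem unfolding M.is_succ_def M.is_set_def by (auto simp: set_eq_iff)

lemma is_succ_num_iff:
  assumes "y \<in> N2"
  shows "M.is_succ y (num n) \<longleftrightarrow> y = num (Suc n)"
proof -
  have *: "elems (num (Suc n)) = insert (num n) (elems (num n))"
    using num[of n] num[of "Suc n"] by (simp add: lessThan_Suc)
  have "M.is_succ y (num n) \<longleftrightarrow> \<not> atom y \<and> elems y = elems (num (Suc n))"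
    unfolding is_succ_iff[OF num_N2 assms] * ..
  also have "\<dots> \<longleftrightarrow> y = num (Suc n)"
    using num[of "Suc n"] set_eqI by (auto)
  finally show ?thesis .
qed

lemma is_empty_iff:
  assumes "x \<in> N2"
  shows "M.is_empty x \<longleftrightarrow> x = num 0"
proof -
  have "M.is_empty x \<longleftrightarrow> \<not> atom x \<and> elems x = {}"
    using assms N2_mem unfolding M.is_empty_def M.is_set_def by (auto simp: set_eq_iff)
  also have "\<dots> \<longleftrightarrow> x = num 0"
    using num[of 0] set_eqI[of x "num 0"] by (auto)
  finally show ?thesis .
qed

lemma in_two_iff:
  assumes "i \<in> N2"
  shows "M.in_two i \<longleftrightarrow> i = num 0 \<or> i = num 1"
  unfolding M.in_two_def using assms is_empty_iff is_succ_num_iff[of i 0] num_N2[of 0]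
  by auto

text \<open>The set from \<open>omega_N2\<close> is inductive in the model, which excludes
  nonstandard numbers; conversely every inductive set of the model contains each
  \<open>num k\<close> by induction.\<close>

lemma is_nat_iff:
  assumes "n \<in> N2"
  shows "M.is_nat n \<longleftrightarrow> n \<in> range num"
proof
  obtain W where W: "W \<in> N2" "\<not> atom W" "elems W = range num" using omega_N2 by blast
  then have mem: "z \<^bold>\<in> W \<longleftrightarrow> z \<in> range num" for z by (simp flip: mem_elems)
  have "M.is_inductive W"
    unfolding M.is_inductive_def M.is_set_def
  proof (intro conjI ballI impI)
    show "\<exists>z\<in>N2. M.is_empty z \<and> z \<^bold>\<in> W" using is_empty_iff num_N2 mem by blast
    fix x assume "x \<in> N2" "x \<^bold>\<in> W"
    then obtain k where "x = num k" using mem by blast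
    then show "\<exists>y\<in>N2. M.is_succ y x \<and> y \<^bold>\<in> W" using is_succ_num_iff num_N2 mem by blast
  qed (use W in auto)
  then show "n \<in> range num" if "M.is_nat n"
    using that W(1) mem unfolding M.is_nat_def by blast
next
  assume "n \<in> range num"
  moreover have "num k \<^bold>\<in> I" if I: "I \<in> N2" "M.is_inductive I" for I k
  proof (induction k)
    case 0
    show ?case using that is_empty_iff unfolding M.is_inductive_def by blast
  next
    case (Suc k)
    obtain y where "y \<in> N2" "M.is_succ y (num k)" "y \<^bold>\<in> I"
      using Suc I(2) num_N2[of k] unfolding M.is_inductive_def by blast
    then show ?case using is_succ_num_iff by metis
  qed
  ultimately show "M.is_nat n" using assms unfolding M.is_nat_def by blast
qed

lemma is_function_pair:
  assumes "f \<in> N2" "M.is_function f S T" "x \<in> N2" "y \<in> N2" "opair x y \<^bold>\<in> f"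
  shows "S x \<and> T y"
proof -
  have "\<exists>x'\<in>N2. \<exists>y'\<in>N2. S x' \<and> T y' \<and> M.is_opair (opair x y) x' y'"
    using assms(2,5) opair_N2[OF assms(3,4)] unfolding M.is_function_def by blast
  then show ?thesis using is_opair_iff[OF opair_N2[OF assms(3,4)]] opair_inject by metis
qed

lemma is_function_value:
  assumes "M.is_function f S T" "x \<in> N2" "S x"
  shows "\<exists>!y. y \<in> N2 \<and> opair x y \<^bold>\<in> f"
proof -
  have "\<exists>!y. y \<in> N2 \<and> M.maps_to f x y" using assms unfolding M.is_function_def by blast
  moreover have "(y \<in> N2 \<and> M.maps_to f x y) = (y \<in> N2 \<and> opair x y \<^bold>\<in> f)" for y
    using maps_to_iff[OF assms(2)] by blast
  ultimately show ?thesis by simp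
qed

text \<open>A bijection of the model is read as a HOL map on the finitely many elements of some
  \<open>num k\<close>, and its image covers \<open>elems x\<close>.\<close>

lemma finite_if_is_finite:
  assumes "M.is_finite x"
  shows "finite (elems x)"
proof -
  obtain n f where n: "n \<in> N2" "M.is_nat n" and f: "f \<in> N2" "M.is_bijection f n x"
    using assms unfolding M.is_finite_def by blast
  have x: "x \<in> N2" using assms unfolding M.is_finite_def M.is_set_def by blast
  have fn: "M.is_function f (\<lambda>z. z \<^bold>\<in> n) (\<lambda>w. w \<^bold>\<in> x)"
    using f(2) unfolding M.is_bijection_def by blast
  obtain k where "n = num k" using is_nat_iff n by blast
  then have "finite (elems n)" using num[of k] by simp
  moreover have "elems x \<subseteq> (\<lambda>z. THE w. w \<in> N2 \<and> opair z w \<^bold>\<in> f) ` elems n"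
  proof
    fix w assume "w \<in> elems x"
    then have w: "w \<^bold>\<in> x" "w \<in> N2" using N2_mem[OF x] by auto
    then obtain z where "z \<in> N2" "M.maps_to f z w"
      using f(2) unfolding M.is_bijection_def by blast
    then have z: "z \<in> N2" "opair z w \<^bold>\<in> f" using maps_to_iff w(2) by auto
    then have zn: "z \<^bold>\<in> n" using is_function_pair[OF f(1) fn z(1) w(2)] by blast
    then have "(THE w. w \<in> N2 \<and> opair z w \<^bold>\<in> f) = w"
      using is_function_value[OF fn z(1)] z w(2) by (intro the1_equality) auto
    then show "w \<in> (\<lambda>z. THE w. w \<in> N2 \<and> opair z w \<^bold>\<in> f) ` elems n" using zn by force
  qed
  ultimately show ?thesis using finite_surj by blast
qed

text \<open>The graph \<open>g\<close> of an enumeration is a finite set of pairs from the model, so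
  \<open>set_of_N2\<close> puts the bijection into the model.\<close>

lemma is_finite_if_finite:
  assumes x: "x \<in> N2" "\<not> atom x" and fin: "finite (elems x)"
  shows "M.is_finite x"
proof -
  obtain h where h: "bij_betw h {..<card (elems x)} (elems x)"
    using ex_bij_betw_nat_finite[OF fin] by (auto simp: atLeast0LessThan)
  define n where "n = card (elems x)"
  define g where "g = (\<lambda>i. opair (num i) (h i)) ` {..<n}"
  have hx: "h i \<^bold>\<in> x" if "i < n" for i
    using bij_betwE[OF h] that by (auto simp: n_def)
  have hN: "h i \<in> N2" if "i < n" for i
    using N2_mem[OF x(1) hx[OF that]] .
  have inj: "h i = h j \<Longrightarrow> i = j" if "i < n" "j < n" for i j
    using bij_betw_imp_inj_on[OF h] that unfolding n_def inj_on_def by blast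
  have surj: "\<exists>i<n. w = h i" if "w \<^bold>\<in> x" for w
  proof -
    have "w \<in> h ` {..<n}" using bij_betw_imp_surj_on[OF h] that unfolding n_def by simp
    then show ?thesis by blast
  qed
  have fg: "finite g" by (simp add: g_def)
  have gN: "set_of g \<in> N2"
    using fg hN num_N2 opair_N2 by (intro set_of_N2) (auto simp: g_def)
  have mem_g: "opair z w \<in> g \<longleftrightarrow> (\<exists>i<n. z = num i \<and> w = h i)" for z w
    by (auto simp: g_def opair_inject)
  have maps: "M.maps_to (set_of g) z w \<longleftrightarrow> (\<exists>i<n. z = num i \<and> w = h i)" if "z \<in> N2" "w \<in> N2" for z w
    using maps_to_iff[OF that] fg mem_g by simp
  have "M.is_function (set_of g) (\<lambda>z. z \<^bold>\<in> num n) (\<lambda>w. w \<^bold>\<in> x)"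
    unfolding M.is_function_def M.is_set_def
  proof (intro conjI ballI impI)
    fix p assume p: "p \<in> N2" "p \<^bold>\<in> set_of g"
    then obtain i where i: "i < n" "p = opair (num i) (h i)" using fg by (auto simp: g_def)
    then have "M.is_opair p (num i) (h i)" using is_opair_iff p(1) num_N2 hN by blast
    then show "\<exists>z\<in>N2. \<exists>w\<in>N2. z \<^bold>\<in> num n \<and> w \<^bold>\<in> x \<and> M.is_opair p z w"
      using num_N2[of i] hN[OF i(1)] hx[OF i(1)] i(1) by force
  next
    fix z assume z: "z \<in> N2" "z \<^bold>\<in> num n"
    then obtain i where i: "i < n" "z = num i" by auto
    show "\<exists>!w. w \<in> N2 \<and> M.maps_to (set_of g) z w"
    proof (rule ex1I[of _ "h i"])
      show "h i \<in> N2 \<and> M.maps_to (set_of g) z (h i)" using maps[OF z(1)] hN i by blast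
      show "w = h i" if "w \<in> N2 \<and> M.maps_to (set_of g) z w" for w
        using that maps[OF z(1)] i inj_num by (auto dest: injD)
    qed
  qed (use gN fg not_atom_set_of in auto)
  moreover have "\<exists>!z. z \<in> N2 \<and> M.maps_to (set_of g) z w" if w: "w \<in> N2" "w \<^bold>\<in> x" for w
  proof -
    obtain i where i: "i < n" "w = h i" using surj[OF w(2)] by blast
    show ?thesis
    proof (rule ex1I[of _ "num i"])
      show "num i \<in> N2 \<and> M.maps_to (set_of g) (num i) w" using maps[OF num_N2 w(1)] num_N2 i by blast
      show "z = num i" if "z \<in> N2 \<and> M.maps_to (set_of g) z w" for z
        using that maps[of z w] w(1) i inj by auto
    qed
  qed
  ultimately have "M.is_bijection (set_of g) (num n) x" unfolding M.is_bijection_def by blast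
  moreover have "M.is_nat (num n)" using is_nat_iff num_N2 by blast
  ultimately show ?thesis
    using x gN num_N2 unfolding M.is_finite_def M.is_set_def by blast
qed

lemma in_Fin_set_of:
  assumes "X \<in> N2" "\<not> atom X" "finite S" "S \<subseteq> elems X"
  shows "set_of S \<in> N2" "M.in_Fin X (set_of S)"
proof -
  have "S \<subseteq> N2" using assms(4) N2_mem[OF assms(1)] by auto
  then show S: "set_of S \<in> N2" using assms(3) by (intro set_of_N2)
  have "M.is_finite (set_of S)"
    using S assms(3) by (intro is_finite_if_finite) (simp_all add: not_atom_set_of elems_set_of)
  moreover have "M.is_subset (set_of S) X"
    using S assms not_atom_set_of[OF assms(3)] unfolding M.is_subset_def M.is_set_def by auto
  ultimately show "M.in_Fin X (set_of S)" unfolding M.in_Fin_def by blast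
qed

section \<open>The homogeneous collection in the model\<close>

lemma HT_N2: "M.HT"
  unfolding M.HT_def
proof (intro ballI impI, elim conjE)
  fix X c assume X: "X \<in> N2" and c: "c \<in> N2" and "M.is_infinite X"
    and fn: "M.is_function c (M.in_Fin X) M.in_two"
  then have Xset: "\<not> atom X" and Xinf: "infinite (elems X)"
    using is_finite_if_finite unfolding M.is_infinite_def M.is_set_def by auto
  have XN: "elems X \<subseteq> N2" using N2_mem[OF X] by auto
  obtain E where E: "finite E" "E \<subseteq> {a. atom a}" "pointwise_stabilizer E \<subseteq> stabilizer X"
    using N2_symmetric[OF X] unfolding symmetric_def by blast
  define D where "D = orbit E ` elems X"
  have orbX: "orbit E x \<subseteq> elems X" if "x \<in> elems X" for x
  proof
    fix y assume "y \<in> orbit E x"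
    then obtain \<pi> where \<pi>: "\<pi> \<in> pointwise_stabilizer E" "y = act \<pi> x" unfolding orbit_def by blast
    then have "act \<pi> X = X" using E(3) unfolding stabilizer_def by blast
    then show "y \<in> elems X" using elems_act[OF Xset, of \<pi>] that \<pi>(2) by auto
  qed
  have D: "disjoint_collection D"
    unfolding disjoint_collection_def
  proof (intro conjI)
    have UD: "\<Union>D = elems X" using orbX self_in_orbit unfolding D_def by blast
    have finD: "\<forall>d\<in>D. finite d" using finite_orbit XN unfolding D_def by auto
    show "infinite D"
    proof
      assume "finite D"
      then have "finite (\<Union>D)" using finD by (intro finite_Union) auto
      then show False using Xinf UD by simp
    qed
    show "\<forall>d\<in>D. finite d \<and> d \<noteq> {}" using finD self_in_orbit unfolding D_def by blast
    show "disjoint D"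
    proof (rule disjointI)
      fix a b assume "a \<in> D" "b \<in> D" "a \<noteq> b"
      then obtain x y where "a = orbit E x" "b = orbit E y" unfolding D_def by blast
      then show "a \<inter> b = {}" using orbit_eq \<open>a \<noteq> b\<close> by blast
    qed
  qed
  \<comment> \<open>The coloring passed to \<open>hindman\<close> asks whether \<open>c\<close>
    takes the value \<open>num 0\<close>; the negative answer becomes the value \<open>num 1\<close>
    by \<open>two\<close> below.\<close>
  obtain D' where D': "disjoint_collection D'" "D' \<subseteq> FU D"
    and mono: "(\<forall>u\<in>FU D'. opair (set_of u) (num 0) \<^bold>\<in> c) \<or> (\<forall>u\<in>FU D'. \<not> opair (set_of u) (num 0) \<^bold>\<in> c)"
    using hindman[OF D, of "\<lambda>u. opair (set_of u) (num 0) \<^bold>\<in> c"] by blast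
  have FUD: "finite u \<and> u \<subseteq> elems X \<and> (\<forall>\<pi>\<in>pointwise_stabilizer E. act \<pi> ` u = u)"
    if "u \<in> FU D" for u
  proof -
    obtain F where F: "u = \<Union>F" "F \<subseteq> D" using \<open>u \<in> FU D\<close> by (rule FU_E)
    have "d \<subseteq> elems X" if "d \<in> D" for d using that orbX unfolding D_def by blast
    then have "u \<subseteq> elems X" using F by blast
    moreover have "act \<pi> ` u = u" if "\<pi> \<in> pointwise_stabilizer E" for \<pi>
    proof -
      have "act \<pi> ` d = d" if "d \<in> F" for d
        using act_image_orbit[OF \<open>\<pi> \<in> pointwise_stabilizer E\<close>] F(2) that unfolding D_def by blast
      then show ?thesis unfolding F(1) image_Union by simp
    qed
    ultimately show ?thesis using finite_nonempty_FU[OF D that] by blast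
  qed
  have D'FUD: "finite d" "d \<subseteq> elems X" if "d \<in> D'" for d using FUD that D'(2) by auto
  obtain Pw where Pw: "\<And>y. y \<^bold>\<in> Pw \<longleftrightarrow> \<not> atom y \<and> (\<forall>z. z \<^bold>\<in> y \<longrightarrow> z \<^bold>\<in> X)"
    using powerset[of X] by blast
  obtain Y where Y: "\<not> atom Y" "\<And>y. y \<^bold>\<in> Y \<longleftrightarrow> y \<^bold>\<in> Pw \<and> y \<in> set_of ` D'"
    using separation[of Pw "\<lambda>y. y \<in> set_of ` D'"] by blast
  have "set_of d \<^bold>\<in> Pw" if "d \<in> D'" for d
    using D'FUD[OF that] not_atom_set_of Pw by auto
  then have Yel: "elems Y = set_of ` D'" using Y(2) by (auto simp: set_eq_iff)
  have "set_of d \<in> N2 \<and> M.in_Fin X (set_of d)" if "d \<in> D'" for d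
    using in_Fin_set_of[OF X Xset D'FUD[OF that]] by blast
  then have YN: "elems Y \<subseteq> N2" "\<And>y. y \<in> elems Y \<Longrightarrow> M.in_Fin X y"
    unfolding Yel by blast+
  have "symmetric Y"
  proof (rule symmetric_if_elems_fixed[OF Y(1) E(1,2)])
    fix \<pi> y assume \<pi>: "\<pi> \<in> pointwise_stabilizer E" and "y \<^bold>\<in> Y"
    then obtain d where d: "d \<in> D'" "y = set_of d" using Yel by (auto simp flip: mem_elems)
    then have "act \<pi> ` d = d" using FUD[of d] D'(2) \<pi> by blast
    then show "act \<pi> y = y" using act_set_of[OF D'FUD(1)[OF d(1)], of \<pi>] d(2) by simp
  qed
  then have Y_N2: "Y \<in> N2" using YN(1) by (rule N2_I)
  have inj: "inj_on set_of D'"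
    using set_of_eq_iff D'FUD(1) by (intro inj_onI) blast
  have "infinite (elems Y)"
    unfolding Yel using D'(1) finite_imageD[OF _ inj] unfolding disjoint_collection_def by blast
  then have Yinf: "M.is_infinite Y"
    using Y(1) Y_N2 finite_if_is_finite unfolding M.is_infinite_def M.is_set_def by blast
  have dis: "M.pairwise_disjoint Y"
    unfolding M.pairwise_disjoint_def
  proof (intro ballI impI notI, elim conjE bexE)
    fix x y z assume "x \<^bold>\<in> Y" "y \<^bold>\<in> Y" "x \<noteq> y" and z: "z \<^bold>\<in> x" "z \<^bold>\<in> y"
    then obtain d e where d: "d \<in> D'" "x = set_of d" and e: "e \<in> D'" "y = set_of e"
      using Yel by (auto simp flip: mem_elems)
    have "z \<in> d" "z \<in> e" using z d e D'FUD(1) by auto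
    moreover have "d \<noteq> e" using d e \<open>x \<noteq> y\<close> by blast
    ultimately show False
      using D'(1) d(1) e(1) disjointD[of D' d e] unfolding disjoint_collection_def by blast
  qed
  \<comment> \<open>A finite union formed in the model is pulled back to a member of
    \<open>FU D'\<close>, where the color is under control. Injectivity of \<open>set_of\<close> on
    \<open>D'\<close> carries finiteness over to the preimage \<open>F'\<close>.\<close>
  have FU_Y: "\<exists>v\<in>FU D'. u = set_of v" if u: "u \<in> N2" "M.in_FU Y u" for u
  proof -
    obtain F where F: "F \<in> N2" "M.is_subset F Y" "M.is_finite F" "\<not> M.is_empty F" "M.is_Union u F"
      using u(2) unfolding M.in_FU_def by blast
    have Fel: "elems F \<subseteq> set_of ` D'"
      using F(1,2) N2_mem[OF F(1)] Yel unfolding M.is_subset_def by (auto simp flip: mem_elems)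
    then obtain F' where F': "F' \<subseteq> D'" "elems F = set_of ` F'" by (auto simp: subset_image_iff)
    have "finite (set_of ` F')" using finite_if_is_finite[OF F(3)] F'(2) by simp
    then have finF': "finite F'" using finite_imageD inj_on_subset[OF inj F'(1)] by blast
    have "F' \<noteq> {}"
    proof
      assume "F' = {}"
      then have "elems F = elems (num 0)" using F'(2) num[of 0] by simp
      moreover have "\<not> atom F" using F(2) unfolding M.is_subset_def M.is_set_def by blast
      ultimately have "F = num 0" using num[of 0] by (intro set_eqI) simp_all
      then show False using F(1,4) is_empty_iff by blast
    qed
    then have v: "\<Union>F' \<in> FU D'" using F'(1) finF' unfolding FU_def by blast
    have "finite (\<Union>F')" using finF' F'(1) D'FUD(1) by auto
    moreover have "\<not> atom u" using F(5) unfolding M.is_Union_def M.is_set_def by blast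
    moreover have "elems u = \<Union>F'"
    proof -
      have *: "z \<in> N2 \<Longrightarrow> z \<^bold>\<in> u \<longleftrightarrow> (\<exists>y\<in>N2. y \<^bold>\<in> F \<and> z \<^bold>\<in> y)" for z
        using F(5) unfolding M.is_Union_def by blast
      have memF: "y \<^bold>\<in> F \<longleftrightarrow> (\<exists>d\<in>F'. y = set_of d)" for y
        using F'(2) by (auto simp flip: mem_elems)
      have mem_d: "z \<^bold>\<in> set_of d \<longleftrightarrow> z \<in> d" if "d \<in> F'" for z d
        using D'FUD(1) F'(1) that by auto
      \<comment> \<open>Both sides lie in \<open>N2\<close>, so they can be compared on elements of
        the model, to which \<open>M.is_Union\<close> refers.\<close>
      have "\<Union>F' \<subseteq> N2" using F'(1) D'FUD(2) XN by blast
      moreover have "elems u \<subseteq> N2" using N2_mem[OF u(1)] by auto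
      moreover have "z \<in> elems u \<longleftrightarrow> z \<in> \<Union>F'" if "z \<in> N2" for z
      proof -
        have "z \<in> elems u \<longleftrightarrow> (\<exists>y. y \<^bold>\<in> F \<and> z \<^bold>\<in> y)"
          using *[OF that] N2_mem[OF F(1)] by auto
        also have "\<dots> \<longleftrightarrow> (\<exists>d\<in>F'. z \<^bold>\<in> set_of d)" unfolding memF by blast
        also have "\<dots> \<longleftrightarrow> z \<in> \<Union>F'" using mem_d by simp
        finally show ?thesis .
      qed
      ultimately show ?thesis by blast
    qed
    ultimately have "u = set_of (\<Union>F')" using set_of_elems by metis
    then show ?thesis using v by blast
  qed
  have two: "opair (set_of v) (num 0) \<^bold>\<in> c \<or> opair (set_of v) (num 1) \<^bold>\<in> c" "set_of v \<in> N2"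
    if "v \<in> FU D'" for v
  proof -
    have "v \<in> FU D" using that FU_subset_FU[OF D'(2)] by blast
    then have v: "set_of v \<in> N2" "M.in_Fin X (set_of v)" using FUD in_Fin_set_of[OF X Xset] by auto
    obtain i where i: "i \<in> N2" "opair (set_of v) i \<^bold>\<in> c"
      using is_function_value[OF fn v] by blast
    then have "i = num 0 \<or> i = num 1"
      using is_function_pair[OF c fn v(1) i] in_two_iff by blast
    then show "opair (set_of v) (num 0) \<^bold>\<in> c \<or> opair (set_of v) (num 1) \<^bold>\<in> c" using i(2) by blast
    show "set_of v \<in> N2" by (rule v(1))
  qed
  \<comment> \<open>In the second alternative of \<open>mono\<close> the value \<open>num 0\<close>
    never occurs, so \<open>two\<close> forces \<open>num 1\<close> throughout.\<close>
  have "\<exists>i\<in>{num 0, num 1}. \<forall>v\<in>FU D'. opair (set_of v) i \<^bold>\<in> c"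
    using mono two(1) by blast
  then obtain i where i: "i \<in> {num 0, num 1}" "\<forall>v\<in>FU D'. opair (set_of v) i \<^bold>\<in> c" by blast
  have iN: "i \<in> N2" "M.in_two i" using i(1) num_N2 in_two_iff by auto
  have "M.maps_to c u i" if "u \<in> N2" "M.in_FU Y u" for u
    using FU_Y[OF that] i(2) maps_to_iff[OF that(1) iN(1)] by blast
  then have "M.FU_monochromatic c Y"
    unfolding M.FU_monochromatic_def using iN by blast
  then show "\<exists>Y\<in>N2. M.is_infinite Y \<and> (\<forall>y\<in>N2. y \<^bold>\<in> Y \<longrightarrow> M.in_Fin X y) \<and>
      M.pairwise_disjoint Y \<and> M.FU_monochromatic c Y"
    using Y_N2 Yinf dis YN(2) by (intro bexI[of _ Y]) auto
qed

end

theorem theorem3p6: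
  fixes mem :: "'v \<Rightarrow> 'v \<Rightarrow> bool"
    and atom :: "'v \<Rightarrow> bool"
    and P :: "nat \<Rightarrow> 'v set"
  assumes "second_fraenkel mem atom P"
  shows "set_structure.HT (second_fraenkel.N2 mem atom P) mem atom"
proof -
  interpret second_fraenkel mem atom P by fact
  show ?thesis by (rule HT_N2)
qed

end
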